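(* Let $p$ be any prime, let $\alpha\ge 1$, $k\ge 0$, $n\ge 0$ be integers and let $r$ be any integer. Then $$T^p_{k,\alpha+1}(n,r)\equiv(-1)^{\bar r}\binom{\bar n}{\bar r}\,T^p_{k,\alpha}\left(\left[\tfrac np\right],\left[\tfrac rp\right]\right)\pmod p.$$
   Context: $[x]$ is the greatest integer $\le x$, and $\bar n,\bar r\in\{0,\dots,p-1\}$ are the residues of $n,r$ mod $p$. For integers $n,\alpha,k\ge 0$ and $r\in\mathbb Z$, $$T^p_{k,\alpha}(n,r)=\frac{k!\,p^k}{[n/p^{\alpha-1}]!}\sum_{i\in\mathbb Z}(-1)^{p^\alpha i+r}\binom{n}{p^\alpha i+r}\binom{i}{k},$$ where $\binom nj=0$ for $j<0$ or $j>n$, and $\binom ik=i(i-1)\cdots(i-k+1)/k!$. For $\alpha\ge1$ these rational numbers are known to be $p$-integral, and the congruence is in $\mathbb Z_{(p)}$. *)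

theory Defs
  imports Complex_Main "HOL-Library.Groups_Big_Fun" "HOL-Computational_Algebra.Primes"
begin

definition int_choose :: "nat \<Rightarrow> int \<Rightarrow> nat" where
  "int_choose n j = (if j < 0 then 0 else n choose nat j)"

(* The sum ranges over all integers i; Sum_any sums a function of finite support.
   The support is finite for p > 0 (lemma below), so its default value for infinite
   support is not used.  The powers with integer exponents (powi) allow for negative
   p^\<alpha> i + r, where the summand vanishes, and for \<alpha> = 0 in p^(\<alpha> - 1). *)
definition T :: "nat \<Rightarrow> nat \<Rightarrow> nat \<Rightarrow> nat \<Rightarrow> int \<Rightarrow> rat" where
  "T p k \<alpha> n r =
     fact k * of_nat p ^ k / fact (nat \<lfloor>of_nat n / (of_nat p :: rat) powi (int \<alpha> - 1)\<rfloor>) *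
     Sum_any (\<lambda>i::int. (-1) powi (int p ^ \<alpha> * i + r)
                        * of_nat (int_choose n (int p ^ \<alpha> * i + r))
                        * (of_int i gchoose k))"

lemma finite_support_T:
  assumes "p > 0"
  shows "finite {i::int. (-1) powi (int p ^ \<alpha> * i + r)
                   * of_nat (int_choose n (int p ^ \<alpha> * i + r))
                   * (of_int i gchoose k) \<noteq> (0::rat)}"
proof (rule finite_subset)
  let ?q = "int p ^ \<alpha>"
  have q: "?q \<ge> 1" using assms by simp
  show "{i::int. (-1) powi (?q * i + r) * of_nat (int_choose n (?q * i + r))
          * (of_int i gchoose k) \<noteq> (0::rat)} \<subseteq> {- int n - \<bar>r\<bar> .. int n + \<bar>r\<bar>}"
  proof
    fix i :: int
    assume "i \<in> {i. (-1) powi (?q * i + r) * of_nat (int_choose n (?q * i + r))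
          * (of_int i gchoose k) \<noteq> (0::rat)}"
    hence "int_choose n (?q * i + r) \<noteq> 0" by auto
    hence b: "0 \<le> ?q * i + r" "?q * i + r \<le> int n"
      by (auto simp: int_choose_def not_less split: if_splits)
    have "\<bar>i\<bar> \<le> \<bar>?q * i\<bar>"
      using mult_right_mono[OF q, of "\<bar>i\<bar>"] by (simp add: abs_mult)
    thus "i \<in> {- int n - \<bar>r\<bar> .. int n + \<bar>r\<bar>}" using b by auto
  qed
qed simp

definition loc_ints :: "nat \<Rightarrow> rat set" where
  "loc_ints p = {of_int a / of_int b | a b. \<not> int p dvd b}"

(* Congruence modulo p in the ring of p-integral rationals: both sides belong to the ring. *)
definition loc_cong :: "nat \<Rightarrow> rat \<Rightarrow> rat \<Rightarrow> bool" where
  "loc_cong p x y \<longleftrightarrow>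
     x \<in> loc_ints p \<and> y \<in> loc_ints p \<and> (\<exists>z\<in>loc_ints p. x - y = of_nat p * z)"

end

theory Submission
  imports Defs "HOL-Computational_Algebra.Polynomial"
begin

text \<open>
  Up to the factor \<open>1 / [n / p\<^sup>\<alpha>\<^sup>-\<^sup>1]!\<close>, the number \<open>T p k \<alpha> n r\<close> is the value at \<open>(1 - x)\<^sup>n\<close> of the
  linear functional that weights the coefficient of \<open>x\<^sup>j\<close> by \<open>k! p\<^sup>k (i choose k)\<close> if \<open>j = p\<^sup>\<alpha> i + r\<close>
  and by 0 otherwise. Write \<open>(1 - x)\<^sup>p = (1 - x\<^sup>p) + p (1 - x) h\<close> with an integer polynomial \<open>h\<close>.
  With \<open>n = p m + t\<close> and \<open>t < p\<close>, the binomial theorem for \<open>((1 - x)\<^sup>p)\<^sup>m\<close> expresses the sum for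
  \<open>(\<alpha> + 1, n)\<close> through the sums for \<open>(\<alpha>, m - j)\<close>, \<open>j \<le> m\<close>, with coefficients
  \<open>(m choose j) p\<^sup>j [(m - j) / p\<^sup>\<alpha>\<^sup>-\<^sup>1]! / [m / p\<^sup>\<alpha>\<^sup>-\<^sup>1]!\<close>. These are multiples of \<open>p\<close> for \<open>j > 0\<close>, and the
  term \<open>j = 0\<close> is the right-hand side of the congruence. The same expansion carries integrality
  from \<open>\<alpha>\<close> to \<open>\<alpha> + 1\<close>. For \<open>\<alpha> = 1\<close> integrality follows by induction on \<open>k\<close>: the case \<open>k = 0\<close>
  reduces \<open>(1 - x)\<^sup>n\<close> modulo \<open>1 - x\<^sup>p\<close>, and the step uses \<open>j (n choose j) = n (n - 1 choose j - 1)\<close>.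
\<close>

subsection \<open>The local ring\<close>

lemma loc_ints_of_int: "prime p \<Longrightarrow> of_int a \<in> loc_ints p"
  unfolding loc_ints_def
  by (intro CollectI exI[of _ a] exI[of _ "1::int"]) (auto dest: prime_gt_1_nat)

lemma loc_ints_of_nat: "prime p \<Longrightarrow> of_nat a \<in> loc_ints p"
  using loc_ints_of_int[of p "int a"] by simp

lemma loc_ints_mult:
  assumes "prime p" "x \<in> loc_ints p" "y \<in> loc_ints p"
  shows "x * y \<in> loc_ints p"
proof -
  obtain a b c d where ab: "x = of_int a / of_int b" "\<not> int p dvd b"
    and cd: "y = of_int c / of_int d" "\<not> int p dvd d"
    using assms(2,3) unfolding loc_ints_def by auto
  have "\<not> int p dvd b * d"
    using ab cd assms(1) by (simp add: prime_dvd_mult_iff)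
  moreover have "x * y = of_int (a * c) / of_int (b * d)"
    using ab cd by simp
  ultimately show ?thesis unfolding loc_ints_def by blast
qed

lemma loc_ints_add:
  assumes "prime p" "x \<in> loc_ints p" "y \<in> loc_ints p"
  shows "x + y \<in> loc_ints p"
proof -
  obtain a b c d where ab: "x = of_int a / of_int b" "\<not> int p dvd b"
    and cd: "y = of_int c / of_int d" "\<not> int p dvd d"
    using assms(2,3) unfolding loc_ints_def by auto
  have "\<not> int p dvd b * d"
    using ab cd assms(1) by (simp add: prime_dvd_mult_iff)
  moreover have "b \<noteq> 0" "d \<noteq> 0" using ab cd by auto
  hence "x + y = of_int (a * d + c * b) / of_int (b * d)"
    using ab cd by (simp add: field_simps)
  ultimately show ?thesis unfolding loc_ints_def by blast
qed

lemma loc_ints_minus: "prime p \<Longrightarrow> x \<in> loc_ints p \<Longrightarrow> - x \<in> loc_ints p"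
  using loc_ints_mult[OF _ loc_ints_of_int[of p "-1"], of x] by simp

lemma loc_ints_diff:
  "prime p \<Longrightarrow> x \<in> loc_ints p \<Longrightarrow> y \<in> loc_ints p \<Longrightarrow> x - y \<in> loc_ints p"
  using loc_ints_add[OF _ _ loc_ints_minus, of p x y] by simp

lemma loc_ints_sum:
  "prime p \<Longrightarrow> (\<And>i. i \<in> I \<Longrightarrow> f i \<in> loc_ints p) \<Longrightarrow> sum f I \<in> loc_ints p"
  using loc_ints_of_int[of p 0]
  by (induction I rule: infinite_finite_induct) (auto intro!: loc_ints_add)

lemma loc_ints_divide:
  assumes "\<not> p dvd u" shows "(of_nat a / of_nat u :: rat) \<in> loc_ints p"
proof -
  have "(of_nat a / of_nat u :: rat) = of_int (int a) / of_int (int u)" by simp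
  moreover have "\<not> int p dvd int u" using assms by simp
  ultimately show ?thesis unfolding loc_ints_def by blast
qed

subsection \<open>Factorials\<close>

text \<open>One step of Legendre's formula: only the multiples of p up to n contribute, and dividing
  each of them by p leaves the factors of \<open>fact (n div p)\<close>.\<close>

lemma multiplicity_fact_div:
  assumes p: "prime (p::nat)"
  shows "multiplicity p (fact n :: nat) = n div p + multiplicity p (fact (n div p) :: nat)"
proof (induction n)
  case 0
  show ?case by simp
next
  case (Suc n)
  have unit: "\<not> is_unit p" using p not_prime_1 by auto
  have mf: "multiplicity p (fact (Suc k) :: nat) = multiplicity p (Suc k) + multiplicity p (fact k :: nat)" for k
    using p by (simp only: fact_Suc of_nat_id)
      (rule prime_elem_multiplicity_mult_distrib, auto)
  show ?case
  proof (cases "p dvd Suc n")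
    case True
    hence d: "Suc n div p = Suc (n div p)" by (simp add: div_Suc dvd_eq_mod_eq_0)
    have "Suc n = p * Suc (n div p)" using True d by (metis dvd_mult_div_cancel)
    hence "multiplicity p (Suc n) = Suc (multiplicity p (Suc (n div p)))"
      using multiplicity_times_same[of "Suc (n div p)" p] unit p by auto
    thus ?thesis using Suc d by (simp only: mf)
  next
    case False
    hence d: "Suc n div p = n div p" by (simp add: div_Suc dvd_eq_mod_eq_0)
    thus ?thesis using Suc not_dvd_imp_multiplicity_0[OF False] by (simp only: mf add_0)
  qed
qed

text \<open>With \<open>m = n div p\<close> the bound reproduces itself, as m + (m - 1) div (p - 1)
  = (p m - 1) div (p - 1) and p m \<le> n. A bound with n for n - 1 would leave no spare factor p in
  p^j / j! when p = 2.\<close>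

lemma multiplicity_fact_le:
  assumes p: "prime (p::nat)"
  shows "multiplicity p (fact n :: nat) \<le> (n - 1) div (p - 1)"
proof (induction n rule: less_induct)
  case (less n)
  have p2: "p \<ge> 2" using p by (rule prime_ge_2_nat)
  show ?case
  proof (cases "n div p = 0")
    case True
    thus ?thesis by (simp add: multiplicity_fact_div[OF p, of n])
  next
    case False
    define m where "m = n div p"
    have m: "m > 0" using False by (simp add: m_def)
    have "m < n" using m p2 unfolding m_def by (intro div_less_dividend) (auto intro: Nat.gr0I)
    hence "multiplicity p (fact m :: nat) \<le> (m - 1) div (p - 1)" by (rule less)
    hence "multiplicity p (fact n :: nat) \<le> m + (m - 1) div (p - 1)"
      using multiplicity_fact_div[OF p, of n] by (simp add: m_def)
    also have "\<dots> = (m * (p - 1) + (m - 1)) div (p - 1)"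
      using p2 by simp
    also have "m * (p - 1) + (m - 1) = p * m - 1"
      using m p2 by (cases p; cases m) (auto simp: algebra_simps)
    also have "(p * m - 1) div (p - 1) \<le> (n - 1) div (p - 1)"
      by (intro div_le_mono diff_le_mono) (simp add: m_def)
    finally show ?thesis .
  qed
qed

lemma loc_ints_power_div_fact:
  assumes p: "prime p" and s: "(n - 1) div (p - 1) \<le> s"
  shows "of_nat p ^ s / fact n \<in> loc_ints p"
proof -
  have "multiplicity p (fact n :: nat) \<le> s"
    using multiplicity_fact_le[OF p, of n] s by simp
  then obtain c where c: "s = multiplicity p (fact n :: nat) + c"
    using le_Suc_ex by blast
  obtain u where u: "fact n = p ^ multiplicity p (fact n :: nat) * u" "\<not> p dvd u"
    using multiplicity_decompose'[of "fact n :: nat" p] p not_prime_1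
    by (metis fact_nonzero not_prime_unit)
  have "(fact n :: rat) = of_nat (fact n)" by simp
  also have "\<dots> = of_nat p ^ multiplicity p (fact n :: nat) * of_nat u"
    by (subst u(1)) simp
  finally have "of_nat p ^ s / fact n = (of_nat (p ^ c) / of_nat u :: rat)"
    using p by (simp add: c power_add)
  thus ?thesis using loc_ints_divide[OF u(2), of "p ^ c"] by simp
qed

text \<open>The quotient \<open>b! / [b / P]!\<close> gains the factor \<open>P\<close> or \<open>b + 1\<close> when \<open>b\<close> increases by 1.\<close>

lemma fact_div_dvd:
  fixes a b P :: nat
  assumes "P > 0" "a \<le> b"
  shows "fact (b div P) * fact a dvd (fact (a div P) * fact b :: nat)"
  using assms(2)
proof (induction b rule: dec_induct)
  case base
  show ?case by simp
next
  case (step b)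
  show ?case
  proof (cases "P dvd Suc b")
    case True
    hence d: "Suc b div P = Suc (b div P)" by (simp add: div_Suc dvd_eq_mod_eq_0)
    have "Suc b = P * Suc (b div P)" using True d by (metis dvd_mult_div_cancel)
    hence "fact (Suc b) = P * Suc (b div P) * (fact b :: nat)"
      by (metis fact_Suc of_nat_id)
    hence "fact (a div P) * fact (Suc b) = P * (Suc (b div P) * (fact (a div P) * fact b :: nat))"
      by (simp only: mult_ac)
    moreover have "fact (Suc b div P) * fact a = Suc (b div P) * (fact (b div P) * fact a :: nat)"
      by (simp only: d fact_Suc of_nat_id mult_ac)
    ultimately show ?thesis using step.IH by (metis dvd_mult mult_dvd_mono dvd_refl)
  next
    case False
    hence d: "Suc b div P = b div P" by (simp add: div_Suc dvd_eq_mod_eq_0)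
    show ?thesis using step.IH unfolding d fact_Suc
      by (metis dvd_mult mult.left_commute)
  qed
qed

text \<open>Writing the binomial as m! / (j! (m - j)!) splits off p^j / j!. The remaining quotient
  of factorials is an integer by \<open>fact_div_dvd\<close>, and p^(j - 1) / j! is already
  p-integral, so one factor p is left over.\<close>

lemma loc_ints_binomial_fact_quotient:
  assumes p: "prime p" and P: "P > 0" and j: "0 < j" "j \<le> m"
  shows "\<exists>z\<in>loc_ints p. of_nat (m choose j) * of_nat p ^ j * fact ((m - j) div P) / fact (m div P)
            = of_nat p * z"
proof -
  obtain c where c: "fact ((m - j) div P) * fact m = fact (m div P) * fact (m - j) * (c::nat)"
    using fact_div_dvd[OF P, of "m - j" m] by (auto elim: dvdE)
  have c': "fact ((m - j) div P) * fact m = fact (m div P) * fact (m - j) * (of_nat c :: rat)"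
    using arg_cong[OF c, of "of_nat :: nat \<Rightarrow> rat"] by simp
  have "(j - 1) div (p - 1) \<le> j - 1" by (rule div_le_dividend)
  hence l: "of_nat p ^ (j - 1) / fact j * of_nat c \<in> loc_ints p"
    by (intro loc_ints_mult p loc_ints_power_div_fact loc_ints_of_nat)
  have b: "of_nat (m choose j) = (fact m / (fact j * fact (m - j)) :: rat)"
    using j(2) by (rule binomial_fact)
  have "of_nat (m choose j) * of_nat p ^ j * fact ((m - j) div P) / fact (m div P)
      = of_nat p ^ j / fact j * (fact ((m - j) div P) * fact m / (fact (m div P) * fact (m - j)) :: rat)"
    unfolding b by (simp add: field_simps)
  also have "\<dots> = of_nat p ^ j / fact j * of_nat c"
    unfolding c' by simp
  also have "\<dots> = of_nat p * (of_nat p ^ (j - 1) / fact j * of_nat c)"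
    using j(1) by (cases j) auto
  finally show ?thesis using l by blast
qed

subsection \<open>Weighted sums of coefficients\<close>

text \<open>The linear functional with value \<open>w j\<close> at x^j; multiplication by x becomes
  a shift of the weight.\<close>

definition wsum :: "(int \<Rightarrow> rat) \<Rightarrow> int poly \<Rightarrow> rat" where
  "wsum w P = (\<Sum>j\<le>degree P. of_int (coeff P j) * w (int j))"

lemma wsum_eq: "degree P \<le> n \<Longrightarrow> wsum w P = (\<Sum>j\<le>n. of_int (coeff P j) * w (int j))"
  unfolding wsum_def by (intro sum.mono_neutral_left) (auto simp: coeff_eq_0)

lemma wsum_0 [simp]: "wsum w 0 = 0"
  by (simp add: wsum_def)

lemma wsum_add: "wsum w (P + Q) = wsum w P + wsum w Q"
proof -
  let ?n = "max (degree P) (degree Q)"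
  have "degree (P + Q) \<le> ?n" by (rule degree_add_le) auto
  thus ?thesis
    by (simp add: wsum_eq[of _ ?n] sum.distrib[symmetric] distrib_right)
qed

lemma wsum_smult: "wsum w (smult c P) = of_int c * wsum w P"
  by (simp add: wsum_eq[of "smult c P" "degree P"] wsum_def sum_distrib_left mult.assoc)

lemma wsum_sum: "wsum w (sum f I) = (\<Sum>i\<in>I. wsum w (f i))"
  by (induction I rule: infinite_finite_induct) (auto simp: wsum_add)

lemma wsum_zero_weight: "(\<And>j. w j = 0) \<Longrightarrow> wsum w P = 0"
  by (simp add: wsum_def)

lemma wsum_const: "wsum w [:c:] = of_int c * w 0"
  by (simp add: wsum_def)

lemma wsum_pCons: "wsum w (pCons a P) = of_int a * w 0 + wsum (\<lambda>j. w (j + 1)) P"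
proof -
  have "degree (pCons a P) \<le> Suc (degree P)" by (rule degree_pCons_le)
  thus ?thesis
    by (simp add: wsum_eq[of "pCons a P" "Suc (degree P)"] wsum_def[of _ P] sum.atMost_Suc_shift
        add.commute del: sum.atMost_Suc)
qed

lemma wsum_monom_mult: "wsum w (monom 1 e * P) = wsum (\<lambda>j. w (j + int e)) P"
  by (induction e arbitrary: w) (auto simp: monom_Suc wsum_pCons monom_0 add_ac one_pCons[symmetric])

text \<open>Only P is expanded into monomials; Q stays whole because it will be a polynomial in
  x^p.\<close>

lemma wsum_mult: "wsum w (P * Q) = (\<Sum>e\<le>degree P. of_int (coeff P e) * wsum (\<lambda>j. w (j + int e)) Q)"
proof -
  have "P * Q = (\<Sum>e\<le>degree P. smult (coeff P e) (monom 1 e * Q))"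
    by (subst (1) poly_as_sum_of_monoms[symmetric])
      (simp add: sum_distrib_right smult_monom flip: mult_smult_left)
  thus ?thesis by (simp add: wsum_sum wsum_smult wsum_monom_mult)
qed

lemma wsum_pcompose_monom: "wsum w (pcompose Q (monom 1 p)) = wsum (\<lambda>j. w (int p * j)) Q"
proof (induction Q arbitrary: w)
  case 0
  show ?case by simp
next
  case (pCons a Q)
  show ?case
    by (simp add: pcompose_pCons wsum_add wsum_const wsum_monom_mult pCons.IH wsum_pCons
        algebra_simps)
qed

lemma wsum_loc_ints:
  assumes "prime p" "\<And>j. w j \<in> loc_ints p"
  shows "wsum w P \<in> loc_ints p"
  unfolding wsum_def using assms
  by (intro loc_ints_sum loc_ints_mult loc_ints_of_int) auto

lemma coeff_one_minus_power: "coeff ([:1, -1:] ^ n :: int poly) j = (-1) ^ j * int (n choose j)"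
proof (cases "j \<le> n")
  case True
  thus ?thesis by (simp add: coeff_linear_poly_power)
next
  case False
  have "degree ([:1, -1:] ^ n :: int poly) \<le> n"
    by (rule order_trans[OF degree_power_le]) simp
  thus ?thesis using False by (simp add: coeff_eq_0)
qed

lemma wsum_one_minus_power:
  "wsum w ([:1, -1:] ^ n) = (\<Sum>j\<le>n. (-1) ^ j * of_nat (n choose j) * w (int j))"
proof -
  have "degree ([:1, -1:] ^ n :: int poly) \<le> n"
    by (rule order_trans[OF degree_power_le]) simp
  thus ?thesis by (simp add: wsum_eq[of _ n] coeff_one_minus_power)
qed

text \<open>Weighting by the index is the operator x d/dx, which sends (1 - x)^(n + 1) to -(n + 1) x
  (1 - x)^n.\<close>

lemma wsum_one_minus_power_times_index:
  "wsum (\<lambda>j. of_int j * w j) ([:1, -1:] ^ Suc n)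
     = - of_nat (Suc n) * wsum (\<lambda>j. w (j + 1)) ([:1, -1:] ^ n)"
proof -
  have *: "of_nat (Suc j) * of_nat (Suc n choose Suc j) = (of_nat (Suc n) * of_nat (n choose j) :: rat)" for j
    by (metis Suc_times_binomial of_nat_mult)
  have "wsum (\<lambda>j. of_int j * w j) ([:1, -1:] ^ Suc n)
     = (\<Sum>j\<le>n. (-1) ^ Suc j * (of_nat (Suc j) * of_nat (Suc n choose Suc j)) * w (int (Suc j)))"
    unfolding wsum_one_minus_power by (subst sum.atMost_Suc_shift) (simp add: mult_ac)
  also have "\<dots> = - of_nat (Suc n) * wsum (\<lambda>j. w (j + 1)) ([:1, -1:] ^ n)"
    unfolding wsum_one_minus_power * sum_distrib_left
    by (intro sum.cong refl) (simp add: algebra_simps)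
  finally show ?thesis .
qed

subsection \<open>The binomial of prime exponent\<close>

text \<open>The coefficients of (1 - x)^p - (1 - x^p) are divisible by p, and 1 is a root, which
  yields the extra factor 1 - x. That factor makes the reduction modulo 1 - x^p iterable at a cost
  of only p - 1 powers per step.\<close>

lemma one_minus_power_prime:
  assumes p: "prime p"
  shows "\<exists>h :: int poly. [:1, -1:] ^ p = (1 - monom 1 p) + smult (int p) ([:1, -1:] * h)"
proof -
  let ?D = "[:1, -1:] ^ p - (1 - monom 1 p) :: int poly"
  have p0: "p > 0" using p by (rule prime_gt_0_nat)
  have "int p dvd coeff ?D i" for i
  proof -
    consider "i = 0" | "0 < i" "i < p" | "i = p" "i \<noteq> 0" | "i > p" by linarith
    thus ?thesis
    proof cases
      case 1
      thus ?thesis using p0 by (simp add: coeff_one_minus_power)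
    next
      case 2
      hence "p dvd (p choose i)" using p by (intro dvd_choose_prime) auto
      thus ?thesis using 2 by (simp add: coeff_one_minus_power)
    next
      case 3
      \<comment> \<open>The coefficient at x^p is (-1)^p + 1, which is 0 for odd p and 2 for p =
        2.\<close>
      show ?thesis
      proof (cases "p = 2")
        case True
        thus ?thesis using 3 by (simp add: coeff_one_minus_power)
      next
        case False
        hence "odd p" using p primes_dvd_imp_eq two_is_prime_nat by blast
        thus ?thesis using 3 by (simp add: coeff_one_minus_power)
      qed
    next
      case 4
      thus ?thesis by (simp add: coeff_one_minus_power binomial_eq_0)
    qed
  qed
  hence "[:int p:] dvd ?D" by (simp add: const_poly_dvd_iff)
  then obtain g where g: "?D = smult (int p) g" by (auto elim!: dvdE)
  have "poly ?D 1 = 0" using p0 by (simp add: poly_monom)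
  hence "poly g 1 = 0" using p0 unfolding g by simp
  then obtain h where "g = [:-1, 1:] * h" by (auto simp: poly_eq_0_iff_dvd elim: dvdE)
  hence "g = [:1, -1:] * (- h)" by simp
  thus ?thesis using g by (metis diff_add_cancel add.commute)
qed

subsection \<open>The weights of the sums T\<close>

text \<open>The modulus q will be p^\<alpha>, while the factor p^k keeps the base p; raising
  \<alpha> therefore changes q alone.\<close>

definition weight :: "nat \<Rightarrow> nat \<Rightarrow> nat \<Rightarrow> int \<Rightarrow> int \<Rightarrow> rat" where
  "weight p q k r j =
     (if int q dvd j - r then fact k * of_nat p ^ k * (of_int ((j - r) div int q) gchoose k) else 0)"

lemma weight_shift: "weight p q k r (j + e) = weight p q k (r - e) j"
  by (simp add: weight_def algebra_simps)

text \<open>If r - e = p d, then p j + e - r = p (j - d), and a factor p cancels against the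
  modulus. This is how \<alpha> + 1 descends to \<alpha>.\<close>

lemma weight_mult:
  assumes "p > 0"
  shows "weight p (q * p) k r (int p * j + e) =
           (if int p dvd r - e then weight p q k ((r - e) div int p) j else 0)"
proof (cases "int p dvd r - e")
  case True
  then obtain d where d: "r - e = int p * d" by (auto elim: dvdE)
  have "int p * j + e - r = int p * (j - d)" using d by (simp add: algebra_simps)
  thus ?thesis using assms d by (simp add: weight_def mult.commute[of "int q"])
next
  case False
  have "\<not> int (q * p) dvd int p * j + e - r"
  proof
    assume "int (q * p) dvd int p * j + e - r"
    hence "int p dvd int p * j + e - r" by (rule dvd_trans[rotated]) simp
    hence "int p dvd int p * j - (int p * j + e - r)" by (rule dvd_diff[OF dvd_triv_left])
    thus False using False by simp
  qed
  thus ?thesis using False by (simp add: weight_def)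
qed

text \<open>For q = p and j = r + p d, the weight k! p^k (d choose k) is the product of j - r - p i
  over i < k; passing to k + 1 appends the factor i = k.\<close>

lemma weight_Suc:
  assumes "p > 0"
  shows "weight p p (Suc k) r j = (of_int j - of_int (r + int p * int k)) * weight p p k r j"
proof (cases "int p dvd j - r")
  case True
  then obtain d where d: "j - r = int p * d" by (auto elim: dvdE)
  hence j: "j = r + int p * d" by simp
  have "fact (Suc k) * ((of_int d :: rat) gchoose Suc k) = (of_int d - of_nat k) * (fact k * (of_int d gchoose k))"
    by (simp only: gbinomial_mult_fact prod.atLeast0_lessThan_Suc mult.commute)
  moreover have "weight p p (Suc k) r j = of_nat p ^ Suc k * (fact (Suc k) * (of_int d gchoose Suc k))"
    using assms unfolding weight_def j by (simp del: fact_Suc)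
  moreover have "weight p p k r j = of_nat p ^ k * (fact k * (of_int d gchoose k))"
    using assms unfolding weight_def j by simp
  moreover have "(of_int j - of_int (r + int p * int k) :: rat) = of_nat p * (of_int d - of_nat k)"
    unfolding j by (simp add: right_diff_distrib)
  ultimately show ?thesis by (simp only: power_Suc mult_ac)
qed (simp add: weight_def)

text \<open>The substitution j = p^\<alpha> i + r maps the support of the sum over i into the
  indices 0..n. Since \<alpha> \<ge> 1, the power under n is a natural number and the floor is
  \<open>div\<close>.\<close>

lemma T_eq_wsum:
  assumes p: "p > 0" and \<alpha>: "\<alpha> \<ge> 1"
  shows "T p k \<alpha> n r = wsum (weight p (p ^ \<alpha>) k r) ([:1, -1:] ^ n) / fact (n div p ^ (\<alpha> - 1))"
proof -
  define q where "q = int p ^ \<alpha>"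
  have q: "q > 0" using p by (simp add: q_def)
  define f where "f = (\<lambda>i::int. (-1) powi (q * i + r) * of_nat (int_choose n (q * i + r))
                        * (of_int i gchoose k) :: rat)"
  define J where "J = {j. j \<le> n \<and> q dvd int j - r}"
  have fin: "finite {i. f i \<noteq> 0}"
    using finite_support_T[OF p, of \<alpha> r n k] by (simp add: f_def q_def)
  have inj: "inj_on (\<lambda>j. (int j - r) div q) J"
    using q by (auto simp: inj_on_def J_def elim!: dvdE)
  have supp: "{i. f i \<noteq> 0} \<subseteq> (\<lambda>j. (int j - r) div q) ` J"
  proof
    fix i assume "i \<in> {i. f i \<noteq> 0}"
    hence "int_choose n (q * i + r) \<noteq> 0" by (auto simp: f_def)
    hence b: "0 \<le> q * i + r" "nat (q * i + r) \<le> n"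
      by (auto simp: int_choose_def not_less split: if_splits)
    hence "nat (q * i + r) \<in> J" "i = (int (nat (q * i + r)) - r) div q"
      using q by (auto simp: J_def)
    thus "i \<in> (\<lambda>j. (int j - r) div q) ` J" by blast
  qed
  have "Sum_any f = (\<Sum>i\<in>(\<lambda>j. (int j - r) div q) ` J. f i)"
    using supp by (intro Sum_any.expand_superset) (auto simp: J_def)
  also have "\<dots> = (\<Sum>j\<in>J. f ((int j - r) div q))"
    using inj by (simp add: sum.reindex)
  also have "\<dots> = (\<Sum>j\<in>J. (-1) ^ j * of_nat (n choose j) * (of_int ((int j - r) div q) gchoose k))"
    by (intro sum.cong) (auto simp: f_def J_def int_choose_def)
  also have "fact k * of_nat p ^ k * \<dots> = (\<Sum>j\<in>J. (-1) ^ j * of_nat (n choose j) * weight p (p ^ \<alpha>) k r (int j))"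
    by (auto simp: sum_distrib_left weight_def J_def q_def intro!: sum.cong)
  also have "\<dots> = wsum (weight p (p ^ \<alpha>) k r) ([:1, -1:] ^ n)"
    unfolding wsum_one_minus_power
    by (intro sum.mono_neutral_left) (auto simp: J_def weight_def q_def)
  finally have S: "fact k * of_nat p ^ k * Sum_any f = wsum (weight p (p ^ \<alpha>) k r) ([:1, -1:] ^ n)" .
  have "(of_nat p :: rat) powi (int \<alpha> - 1) = of_nat (p ^ (\<alpha> - 1))"
    using \<alpha> by (simp add: power_int_def nat_diff_distrib)
  hence "nat \<lfloor>of_nat n / (of_nat p :: rat) powi (int \<alpha> - 1)\<rfloor> = n div p ^ (\<alpha> - 1)"
    by (simp only: floor_divide_of_nat_eq nat_int)
  thus ?thesis using S unfolding T_def f_def q_def by simp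
qed

subsection \<open>Integrality for exponent one\<close>

text \<open>Modulo 1 - x^p, the power (1 - x)^p becomes p (1 - x) h: every further p - 1 factors 1 -
  x produce one factor p, and one factor 1 - x survives for the next round.\<close>

lemma one_minus_power_mod_one_minus_monom:
  assumes p: "prime p"
  shows "\<exists>u v :: int poly. [:1, -1:] ^ Suc ((p - 1) * s) =
           (1 - monom 1 p) * u + smult (int (p ^ s)) ([:1, -1:] * v)"
proof (induction s)
  case 0
  show ?case by (intro exI[of _ 0] exI[of _ 1]) simp
next
  case (Suc s)
  define X :: "int poly" where "X = [:1, -1:]"
  define Y :: "int poly" where "Y = 1 - monom 1 p"
  obtain h where h: "X ^ p = Y + smult (int p) (X * h)"
    using one_minus_power_prime[OF p] unfolding X_def Y_def by blast
  obtain u v where uv: "X ^ Suc ((p - 1) * s) = Y * u + smult (int (p ^ s)) (X * v)"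
    using Suc unfolding X_def Y_def by blast
  have pp: "X * X ^ (p - 1) = X ^ p"
    using prime_gt_0_nat[OF p] by (simp flip: power_Suc)
  have "X ^ Suc ((p - 1) * Suc s) = X ^ Suc ((p - 1) * s) * X ^ (p - 1)"
    by (simp flip: power_add) (simp add: algebra_simps)
  also have "\<dots> = Y * (u * X ^ (p - 1)) + smult (int (p ^ s)) ((X * X ^ (p - 1)) * v)"
    unfolding uv by (simp only: distrib_right mult_smult_left) (simp only: mult_ac)
  also have "\<dots> = Y * (u * X ^ (p - 1) + smult (int (p ^ s)) v) + smult (int (p ^ Suc s)) (X * (h * v))"
    unfolding pp h by (simp add: algebra_simps smult_add_right)
  finally show ?case unfolding X_def Y_def by blast
qed

text \<open>A weight of period p cannot tell u from x^p u. For k = 0 the weight has this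
  period.\<close>

lemma wsum_one_minus_monom_mult:
  assumes "\<And>j. w (j + int p) = w j"
  shows "wsum w ((1 - monom 1 p) * u) = 0"
proof -
  have "wsum w ((1 - monom 1 p) * u) = wsum w (u + smult (-1) (monom 1 p * u))"
    by (simp add: left_diff_distrib)
  also have "\<dots> = 0"
    unfolding wsum_add wsum_smult wsum_monom_mult assms by simp
  finally show ?thesis .
qed

lemma loc_ints_wsum_div_fact:
  assumes p: "prime p"
  shows "wsum (weight p p k r) ([:1, -1:] ^ n) / fact n \<in> loc_ints p"
proof (induction k arbitrary: n r)
  case 0
  have w: "weight p p 0 r j \<in> loc_ints p" for j
    using loc_ints_of_nat[OF p, of 0] loc_ints_of_nat[OF p, of 1] by (simp add: weight_def)
  show ?case
  proof (cases n)
    case 0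
    thus ?thesis using wsum_loc_ints[OF p w] by simp
  next
    case (Suc n')
    \<comment> \<open>Here s = [(n - 1) / (p - 1)]: since 1 + (p - 1) s \<le> n, the power (1 - x)^n
      supplies s factors p modulo 1 - x^p, and s also bounds the p-adic valuation of n!.\<close>
    define s where "s = n' div (p - 1)"
    obtain u v where uv: "[:1, -1:] ^ Suc ((p - 1) * s) =
        (1 - monom 1 p) * u + smult (int (p ^ s)) ([:1, -1:] * v :: int poly)"
      using one_minus_power_mod_one_minus_monom[OF p] by blast
    define X :: "int poly" where "X = [:1, -1:] ^ (n' mod (p - 1))"
    have per: "int p dvd j + int p - r \<longleftrightarrow> int p dvd j - r" for j
      using dvd_add_times_triv_right_iff[of "int p" "j - r" 1] by (simp add: algebra_simps)
    have "n = Suc ((p - 1) * s) + n' mod (p - 1)" by (simp add: Suc s_def)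
    hence "[:1, -1:] ^ n = ((1 - monom 1 p) * u + smult (int (p ^ s)) ([:1, -1:] * v)) * X"
      by (simp only: power_add uv X_def)
    also have "\<dots> = (1 - monom 1 p) * (u * X) + smult (int (p ^ s)) ([:1, -1:] * v * X)"
      by (simp only: distrib_right mult_smult_left mult.assoc)
    also have "wsum (weight p p 0 r) \<dots> = of_nat p ^ s * wsum (weight p p 0 r) ([:1, -1:] * v * X)"
      unfolding wsum_add wsum_smult
      by (subst wsum_one_minus_monom_mult) (simp_all add: weight_def per)
    finally have "wsum (weight p p 0 r) ([:1, -1:] ^ n)
        = of_nat p ^ s * wsum (weight p p 0 r) ([:1, -1:] * v * X)" .
    hence "wsum (weight p p 0 r) ([:1, -1:] ^ n) / fact n
        = of_nat p ^ s / fact n * wsum (weight p p 0 r) ([:1, -1:] * v * X)" by (simp only: times_divide_eq_left)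
    moreover have "of_nat p ^ s / fact n \<in> loc_ints p"
      by (rule loc_ints_power_div_fact[OF p]) (simp add: Suc s_def)
    ultimately show ?thesis
      by (metis loc_ints_mult[OF p] wsum_loc_ints[where w = "weight p p 0 r", OF p w])
  qed
next
  case (Suc k)
  have p0: "p > 0" using p by (rule prime_gt_0_nat)
  \<comment> \<open>By \<open>weight_Suc\<close> the new factor is j - c. The part with j lowers n
    and r by 1 and produces a factor n that cancels in n!, which is why the induction keeps n and r
    arbitrary.\<close>
  define c where "c = r + int p * int k"
  define A where "A = wsum (\<lambda>j. of_int j * weight p p k r j) ([:1, -1:] ^ n)"
  have "wsum (weight p p (Suc k) r) ([:1, -1:] ^ n) = A - of_int c * wsum (weight p p k r) ([:1, -1:] ^ n)"
    unfolding wsum_def weight_Suc[OF p0] A_def c_def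
    by (simp add: sum_distrib_left sum_subtractf algebra_simps)
  hence eq: "wsum (weight p p (Suc k) r) ([:1, -1:] ^ n) / fact n
     = A / fact n - of_int c * (wsum (weight p p k r) ([:1, -1:] ^ n) / fact n)"
    by (simp add: diff_divide_distrib)
  have "A / fact n \<in> loc_ints p"
  proof (cases n)
    case 0
    thus ?thesis using loc_ints_of_nat[OF p, of 0] by (simp add: A_def wsum_def)
  next
    case (Suc m)
    have "A = - of_nat (Suc m) * wsum (weight p p k (r - 1)) ([:1, -1:] ^ m)"
      unfolding A_def Suc wsum_one_minus_power_times_index weight_shift ..
    hence "A / fact n = - (wsum (weight p p k (r - 1)) ([:1, -1:] ^ m) / fact m)"
      by (simp add: Suc fact_Suc del: of_nat_Suc)
    thus ?thesis using loc_ints_minus[OF p Suc.IH] by simp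
  qed
  thus ?case unfolding eq
    by (intro loc_ints_diff loc_ints_mult loc_ints_of_int p Suc.IH)
qed

subsection \<open>Raising the exponent\<close>

text \<open>The second factor contributes only exponents divisible by p, so an exponent e of P
  counts only if it is congruent to r.\<close>

lemma wsum_weight_mult_pcompose:
  assumes "p > 0"
  shows "wsum (weight p (q * p) k r) (P * pcompose Q (monom 1 p)) =
    (\<Sum>e | e \<le> degree P \<and> int p dvd r - int e.
       of_int (coeff P e) * wsum (weight p q k ((r - int e) div int p)) Q)"
proof -
  have "wsum (\<lambda>j. weight p (q * p) k r (int p * j + int e)) Q =
     (if int p dvd r - int e then wsum (weight p q k ((r - int e) div int p)) Q else 0)" for e
    unfolding weight_mult[OF assms] by (simp add: wsum_zero_weight)
  hence "wsum (weight p (q * p) k r) (P * pcompose Q (monom 1 p)) =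
    (\<Sum>e\<le>degree P. of_int (coeff P e) *
       (if int p dvd r - int e then wsum (weight p q k ((r - int e) div int p)) Q else 0))"
    unfolding wsum_mult wsum_pcompose_monom by simp
  also have "\<dots> = (\<Sum>e | e \<le> degree P \<and> int p dvd r - int e.
       of_int (coeff P e) * wsum (weight p q k ((r - int e) div int p)) Q)"
    by (intro sum.mono_neutral_cong_right) auto
  finally show ?thesis .
qed

text \<open>The witness is P j = (1 - x)^(n mod p) ((1 - x) h)^j. Only \<open>P 0\<close> is needed
  explicitly; of the others it matters just that their coefficients are integers.\<close>

lemma T_Suc_expansion:
  assumes p: "prime p" and \<alpha>: "\<alpha> \<ge> 1"
  shows "\<exists>P. P 0 = [:1, -1:] ^ (n mod p) \<and>
    T p k (\<alpha> + 1) n r =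
    (\<Sum>j\<le>n div p. of_nat (n div p choose j) * of_nat p ^ j * fact ((n div p - j) div p ^ (\<alpha> - 1))
          / fact (n div p div p ^ (\<alpha> - 1)) *
      (\<Sum>e | e \<le> degree (P j) \<and> int p dvd r - int e.
         of_int (coeff (P j) e) * T p k \<alpha> (n div p - j) ((r - int e) div int p)))"
proof -
  have p0: "p > 0" using p by (rule prime_gt_0_nat)
  define m where "m = n div p"
  define X :: "int poly" where "X = [:1, -1:]"
  obtain h where h: "X ^ p = (1 - monom 1 p) + smult (int p) (X * h)"
    using one_minus_power_prime[OF p] unfolding X_def by blast
  define P where "P j = X ^ (n mod p) * (X * h) ^ j" for j
  let ?W = "\<lambda>\<alpha> r. weight p (p ^ \<alpha>) k r"
  \<comment> \<open>1 - x^p is 1 - x evaluated at x^p, so its powers have the form required by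
    \<open>wsum_weight_mult_pcompose\<close>.\<close>
  have comp: "(1 - monom 1 p) ^ i = pcompose (X ^ i) (monom 1 p)" for i
  proof (induction i)
    case (Suc i)
    have "pcompose X (monom 1 p) = 1 - monom 1 p"
      by (simp add: X_def pcompose_pCons one_pCons)
    thus ?case by (simp only: power_Suc pcompose_mult Suc.IH)
  qed (simp add: one_pCons)
  have "X ^ n = X ^ (n mod p) * (X ^ p) ^ m"
    by (simp add: m_def flip: power_mult power_add)
  also have "\<dots> = X ^ (n mod p) * (\<Sum>j\<le>m. of_nat (m choose j) * (smult (int p) (X * h)) ^ j * (1 - monom 1 p) ^ (m - j))"
    by (simp only: h add.commute[of "1 - monom 1 p"] binomial_ring)
  also have "\<dots> = (\<Sum>j\<le>m. smult (int (m choose j) * int p ^ j) (P j * pcompose (X ^ (m - j)) (monom 1 p)))"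
    unfolding sum_distrib_left comp P_def
    by (intro sum.cong refl) (simp add: of_nat_poly smult_power mult_ac)
  finally have Xn: "X ^ n = \<dots>" .
  have "wsum (?W (\<alpha> + 1) r) (X ^ n) = (\<Sum>j\<le>m. of_nat (m choose j) * of_nat p ^ j *
      (\<Sum>e | e \<le> degree (P j) \<and> int p dvd r - int e.
       of_int (coeff (P j) e) * wsum (?W \<alpha> ((r - int e) div int p)) (X ^ (m - j))))"
    unfolding Xn wsum_sum wsum_smult
    by (simp add: wsum_weight_mult_pcompose[OF p0, of "p ^ \<alpha>"] mult.commute[of p])
  moreover have "wsum (?W \<alpha> s) (X ^ i) = fact (i div p ^ (\<alpha> - 1)) * T p k \<alpha> i s" for i s
    by (simp add: T_eq_wsum[OF p0 \<alpha>] X_def)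
  \<comment> \<open>The normalizing factorials fit together because n div p^\<alpha> = m div
    p^(\<alpha> - 1).\<close>
  moreover have "T p k (\<alpha> + 1) n r = wsum (?W (\<alpha> + 1) r) (X ^ n) / fact (m div p ^ (\<alpha> - 1))"
    using \<alpha> by (subst T_eq_wsum[OF p0]) (auto simp: X_def m_def div_mult2_eq[symmetric] simp flip: power_Suc)
  ultimately have "T p k (\<alpha> + 1) n r = (\<Sum>j\<le>m. of_nat (m choose j) * of_nat p ^ j *
      (\<Sum>e | e \<le> degree (P j) \<and> int p dvd r - int e.
       of_int (coeff (P j) e) * (fact ((m - j) div p ^ (\<alpha> - 1)) * T p k \<alpha> (m - j) ((r - int e) div int p))))
      / fact (m div p ^ (\<alpha> - 1))"
    by simp
  also have "\<dots> = (\<Sum>j\<le>m. of_nat (m choose j) * of_nat p ^ j * fact ((m - j) div p ^ (\<alpha> - 1))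
          / fact (m div p ^ (\<alpha> - 1)) *
      (\<Sum>e | e \<le> degree (P j) \<and> int p dvd r - int e.
         of_int (coeff (P j) e) * T p k \<alpha> (m - j) ((r - int e) div int p)))"
    by (simp add: sum_divide_distrib sum_distrib_left mult_ac)
  finally show ?thesis
    unfolding m_def by (intro exI[of _ P]) (simp add: P_def X_def)
qed

text \<open>Integrality at \<alpha> is a hypothesis, so that this serves both the induction proving
  integrality and the final congruence.\<close>

lemma T_Suc_approx:
  assumes p: "prime p" and \<alpha>: "\<alpha> \<ge> 1"
    and int: "\<And>n r. T p k \<alpha> n r \<in> loc_ints p"
  shows "\<exists>z\<in>loc_ints p. T p k (\<alpha> + 1) n r =
    (-1) ^ nat (r mod int p) * of_nat ((n mod p) choose nat (r mod int p))
      * T p k \<alpha> (n div p) (r div int p) + of_nat p * z"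
proof -
  have p0: "p > 0" using p by (rule prime_gt_0_nat)
  define m where "m = n div p"
  define t where "t = n mod p"
  define \<rho> where "\<rho> = nat (r mod int p)"
  define d where "d j = of_nat (m choose j) * of_nat p ^ j * fact ((m - j) div p ^ (\<alpha> - 1))
          / (fact (m div p ^ (\<alpha> - 1)) :: rat)" for j
  obtain P where P0: "P 0 = [:1, -1:] ^ t" and TP: "T p k (\<alpha> + 1) n r = (\<Sum>j\<le>m. d j *
      (\<Sum>e | e \<le> degree (P j) \<and> int p dvd r - int e.
         of_int (coeff (P j) e) * T p k \<alpha> (m - j) ((r - int e) div int p)))"
    using T_Suc_expansion[OF p \<alpha>, of n k r] unfolding m_def t_def d_def by blast
  define B where "B j = (\<Sum>e | e \<le> degree (P j) \<and> int p dvd r - int e.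
         of_int (coeff (P j) e) * T p k \<alpha> (m - j) ((r - int e) div int p))" for j
  have B: "B j \<in> loc_ints p" for j
    unfolding B_def by (intro loc_ints_sum loc_ints_mult loc_ints_of_int p int)
  have "\<forall>j\<in>{..<m}. \<exists>z. z \<in> loc_ints p \<and> d (Suc j) = of_nat p * z"
  proof
    fix j assume "j \<in> {..<m}"
    hence "\<exists>z\<in>loc_ints p. d (Suc j) = of_nat p * z"
      unfolding d_def using p0 by (intro loc_ints_binomial_fact_quotient p) auto
    thus "\<exists>z. z \<in> loc_ints p \<and> d (Suc j) = of_nat p * z" by blast
  qed
  from bchoice[OF this] obtain z
    where z: "\<And>j. j < m \<Longrightarrow> z j \<in> loc_ints p \<and> d (Suc j) = of_nat p * z j"
    by blast
  have "T p k (\<alpha> + 1) n r = (\<Sum>j\<le>m. d j * B j)"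
    unfolding TP B_def ..
  also have "\<dots> = d 0 * B 0 + (\<Sum>j<m. d (Suc j) * B (Suc j))"
    by (rule sum.atMost_shift)
  also have "d 0 = 1" by (simp add: d_def)
  also have "(\<Sum>j<m. d (Suc j) * B (Suc j)) = of_nat p * (\<Sum>j<m. z j * B (Suc j))"
    using z by (simp add: sum_distrib_left mult.assoc)
  finally have T: "T p k (\<alpha> + 1) n r = B 0 + of_nat p * (\<Sum>j<m. z j * B (Suc j))" by simp
  have "t < p" using p0 by (simp add: t_def)
  have deg: "degree (P 0) \<le> t"
    unfolding P0 by (rule order_trans[OF degree_power_le]) simp
  have \<rho>: "int \<rho> = r mod int p" using p0 by (simp add: \<rho>_def)
  \<comment> \<open>The exponents of \<open>P 0\<close> are below p, so at most one of them lies in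
    the class of r.\<close>
  have eq: "e = \<rho>" if "e \<le> degree (P 0)" "int p dvd r - int e" for e
  proof -
    have "int e < int p" using that(1) deg \<open>t < p\<close> by linarith
    moreover have "r mod int p = int e mod int p" using that(2) by (simp add: mod_eq_dvd_iff)
    ultimately show ?thesis using \<rho> by simp
  qed
  have dvd: "int p dvd r - int \<rho>" by (simp add: \<rho> minus_mod_eq_mult_div)
  have quot: "(r - int \<rho>) div int p = r div int p"
    using p0 by (simp add: \<rho> minus_mod_eq_mult_div)
  \<comment> \<open>If \<open>\<rho>\<close> exceeds the degree, the original index set is empty,
    but then the coefficient at \<open>\<rho>\<close> is 0 as well.\<close>
  have "B 0 = (\<Sum>e\<in>{\<rho>}. of_int (coeff (P 0) e) * T p k \<alpha> m ((r - int e) div int p))"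
    unfolding B_def diff_zero
  proof (rule sum.mono_neutral_left)
    show "{e. e \<le> degree (P 0) \<and> int p dvd r - int e} \<subseteq> {\<rho>}"
      using eq by blast
    show "\<forall>e\<in>{\<rho>} - {e. e \<le> degree (P 0) \<and> int p dvd r - int e}.
        of_int (coeff (P 0) e) * T p k \<alpha> m ((r - int e) div int p) = 0"
      using dvd by (auto intro: le_degree)
  qed simp
  also have "\<dots> = of_int (coeff (P 0) \<rho>) * T p k \<alpha> m (r div int p)"
    by (simp add: quot)
  also have "of_int (coeff (P 0) \<rho>) = (-1) ^ \<rho> * (of_nat (t choose \<rho>) :: rat)"
    unfolding P0 coeff_one_minus_power by simp
  finally have "T p k (\<alpha> + 1) n r =
    (-1) ^ \<rho> * of_nat (t choose \<rho>) * T p k \<alpha> m (r div int p)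
      + of_nat p * (\<Sum>j<m. z j * B (Suc j))" using T by simp
  moreover have "(\<Sum>j<m. z j * B (Suc j)) \<in> loc_ints p"
    using z B by (intro loc_ints_sum loc_ints_mult p) auto
  ultimately show ?thesis unfolding m_def t_def \<rho>_def by blast
qed

lemma loc_ints_sign_mult:
  assumes "prime p" "x \<in> loc_ints p"
  shows "(-1) ^ a * of_nat b * x \<in> loc_ints p"
  using loc_ints_mult[OF assms(1) loc_ints_of_int[OF assms(1), of "(-1) ^ a * int b"] assms(2)]
  by simp

lemma T_loc_ints:
  assumes p: "prime p" and \<alpha>: "\<alpha> \<ge> 1"
  shows "T p k \<alpha> n r \<in> loc_ints p"
  using \<alpha>
proof (induction \<alpha> arbitrary: n r rule: dec_induct)
  case base
  show ?case
    using loc_ints_wsum_div_fact[OF p, of k r n] T_eq_wsum[of p 1 k n r] prime_gt_0_nat[OF p] by simp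
next
  case (step \<alpha>)
  obtain z where z: "z \<in> loc_ints p" "T p k (\<alpha> + 1) n r =
      (-1) ^ nat (r mod int p) * of_nat ((n mod p) choose nat (r mod int p))
        * T p k \<alpha> (n div p) (r div int p) + of_nat p * z"
    using T_Suc_approx[OF p step.hyps(1) step.IH] by blast
  show ?case
    unfolding Suc_eq_plus1 z(2)
    by (rule loc_ints_add[OF p loc_ints_sign_mult[OF p step.IH]
          loc_ints_mult[OF p loc_ints_of_nat[OF p] z(1)]])
qed

theorem theorem3p2:
  fixes p \<alpha> k n :: nat and r :: int
  assumes "prime p" and "\<alpha> \<ge> 1"
  shows "loc_cong p (T p k (\<alpha> + 1) n r)
           ((-1) ^ nat (r mod int p) * of_nat ((n mod p) choose nat (r mod int p))
             * T p k \<alpha> (n div p) (r div int p))"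
  unfolding loc_cong_def
proof (intro conjI)
  show "T p k (\<alpha> + 1) n r \<in> loc_ints p"
    by (rule T_loc_ints) (use assms in auto)
  show "(-1) ^ nat (r mod int p) * of_nat ((n mod p) choose nat (r mod int p))
             * T p k \<alpha> (n div p) (r div int p) \<in> loc_ints p"
    by (intro loc_ints_sign_mult T_loc_ints assms)
  obtain z where z: "z \<in> loc_ints p" "T p k (\<alpha> + 1) n r =
      (-1) ^ nat (r mod int p) * of_nat ((n mod p) choose nat (r mod int p))
        * T p k \<alpha> (n div p) (r div int p) + of_nat p * z"
    using T_Suc_approx[OF assms T_loc_ints[OF assms]] by blast
  show "\<exists>z\<in>loc_ints p. T p k (\<alpha> + 1) n r - (-1) ^ nat (r mod int p) *
      of_nat ((n mod p) choose nat (r mod int p)) * T p k \<alpha> (n div p) (r div int p) = of_nat p * z"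
    by (rule bexI[OF _ z(1)]) (simp only: z(2) add_diff_cancel_left')
qed

end
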